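(* Let $Y=\{1,2\}$ be the cycle set with $x\cdot y=y$ for all $x,y\in Y$, and let $S=\{a,b,c,d\}$ be a set with four elements. Let $\alpha\colon Y\times Y\times S\to\operatorname{Sym}(S)$ be the map given by $$\alpha_{1,1}(a,-)=\alpha_{1,1}(b,-)=\alpha_{2,2}(a,-)=\alpha_{2,2}(b,-)=(c\,d),$$ $$\alpha_{1,1}(c,-)=\alpha_{1,1}(d,-)=\alpha_{2,2}(c,-)=\alpha_{2,2}(d,-)=(a\,b),$$ $$\alpha_{1,2}(a,-)=\alpha_{1,2}(c,-)=\alpha_{2,1}(a,-)=\alpha_{2,1}(c,-)=\operatorname{id},$$ $$\alpha_{1,2}(b,-)=\alpha_{1,2}(d,-)=\alpha_{2,1}(b,-)=\alpha_{2,1}(d,-)=(a\,c)(b\,d).$$ Then $\alpha$ is a dynamical cocycle of $Y$ with values on $S$. Writing $x_1=(a,1)$, $x_2=(a,2)$, $x_3=(b,1)$, $x_4=(b,2)$, $x_5=(c,1)$, $x_6=(c,2)$, $x_7=(d,1)$, $x_8=(d,2)$, the dynamical extension $X=S\times_\alpha Y$ is the square-free cycle set on $\{x_1,\dots,x_8\}$ whose permutations $\psi_x\colon y\mapsto x\cdot y$ are $$\psi_{x_1}=(x_5x_7),\quad \psi_{x_2}=(x_6x_8),\quad \psi_{x_3}=(x_2x_6)(x_4x_8)(x_5x_7),\quad \psi_{x_4}=(x_1x_5)(x_3x_7)(x_6x_8),$$ $$\psi_{x_5}=(x_1x_3),\quad \psi_{x_6}=(x_2x_4),\quad \psi_{x_7}=(x_1x_3)(x_2x_6)(x_4x_8),\quad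 \psi_{x_8}=(x_1x_5)(x_2x_4)(x_3x_7).$$ Moreover, the map $r\colon X\times X\to X\times X$, $r(x_i,x_j)=(\psi_{x_i}(x_j),\psi_{x_j}(x_i))$, is a nondegenerate involutive square-free set-theoretic solution of the Yang--Baxter equation which satisfies $\operatorname{Ret}(X,r)=(X,r)$ (that is, the retract relation on $X$ is equality), and hence $(X,r)$ is not a multipermutation solution.
   Context: A cycle set is a set $X$ with a binary operation $(x,y)\mapsto x\cdot y$ such that for each $x\in X$ the map $y\mapsto x\cdot y$ is bijective and $(x\cdot y)\cdot(x\cdot z)=(y\cdot x)\cdot(y\cdot z)$ for all $x,y,z\in X$. It is square-free if $x\cdot x=x$ for all $x\in X$. Let $Y$ be a finite cycle set, $S$ a finite nonempty set, and $\operatorname{Sym}(S)$ the set of permutations of $S$. A dynamical cocycle of $Y$ with values on $S$ is a map $\alpha\colon Y\times Y\times S\to \operatorname{Sym}(S)$, $(x,y,s)\mapsto\alpha_{x,y}(s,-)$ (where $\alpha_{x,y}(s,-)$ denotes the map $t\mapsto\alpha_{x,y}(s,t)$), such that $$\alpha_{x\cdot y,x\cdot z}(\alpha_{x,y}(r,s),\alpha_{x,z}(r,t))=\alpha_{y\cdot x,y\cdot z}(\alpha_{y,x}(s,r),\alpha_{y,z}(s,t))$$ for all $x,y,z\in Y$, $r,s,t\in S$. The dynamical extension $S\times_\alpha Y$ is the set $S\times Y$ with the operation $(s,x)\cdot(t,y)=(\alpha_{x,y}(s,t),x\cdot y)$. A set-theoretic solution of the Yang--Baxter equation is a pair $(X,r)$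 with $X$ a nonempty set and $r\colon X\times X\to X\times X$ a bijective map, written $r(x,y)=(\sigma_x(y),\tau_y(x))$, such that $r_{12}r_{23}r_{12}=r_{23}r_{12}r_{23}$ on $X\times X\times X$, where $r_{12}=r\times\operatorname{id}$ and $r_{23}=\operatorname{id}\times r$. It is involutive if $r^2=\operatorname{id}$, nondegenerate if all $\sigma_x$ and $\tau_x$ are bijective, and square-free if $r(x,x)=(x,x)$ for all $x\in X$. For a finite nondegenerate involutive solution $(X,r)$, the retract relation is $x\sim y$ if and only if $\sigma_x=\sigma_y$, and the retraction $\operatorname{Ret}(X,r)$ is the solution on $X/{\sim}$ given by $\overline r([x],[y])=([\sigma_x(y)],[\tau_y(x)])$. Iterated retractions are $\operatorname{Ret}^1=\operatorname{Ret}$ and $\operatorname{Ret}^k(X,r)=\operatorname{Ret}(\operatorname{Ret}^{k-1}(X,r))$ for $k>1$. $(X,r)$ is a multipermutation solution if there is $m>0$ such that $\operatorname{Ret}^m(X,r)$ has cardinality one. *)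

theory Defs
  imports "HOL-Combinatorics.Transposition" "HOL-Combinatorics.Permutations" "HOL-Library.FSet"
begin

definition cycle_set :: "'a set \<Rightarrow> ('a \<Rightarrow> 'a \<Rightarrow> 'a) \<Rightarrow> bool" where
  "cycle_set X m \<longleftrightarrow>
     (\<forall>x\<in>X. bij_betw (m x) X X) \<and>
     (\<forall>x\<in>X. \<forall>y\<in>X. \<forall>z\<in>X. m (m x y) (m x z) = m (m y x) (m y z))"

definition square_free_cycle_set :: "'a set \<Rightarrow> ('a \<Rightarrow> 'a \<Rightarrow> 'a) \<Rightarrow> bool" where
  "square_free_cycle_set X m \<longleftrightarrow> cycle_set X m \<and> (\<forall>x\<in>X. m x x = x)"

definition dynamical_cocycle ::
  "'y set \<Rightarrow> ('y \<Rightarrow> 'y \<Rightarrow> 'y) \<Rightarrow> 's set \<Rightarrow> ('y \<Rightarrow> 'y \<Rightarrow> 's \<Rightarrow> 's \<Rightarrow> 's) \<Rightarrow> bool" where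
  "dynamical_cocycle Y m S \<alpha> \<longleftrightarrow>
     finite Y \<and> cycle_set Y m \<and> finite S \<and> S \<noteq> {} \<and>
     (\<forall>x\<in>Y. \<forall>y\<in>Y. \<forall>s\<in>S. \<alpha> x y s permutes S) \<and>
     (\<forall>x\<in>Y. \<forall>y\<in>Y. \<forall>z\<in>Y. \<forall>r\<in>S. \<forall>s\<in>S. \<forall>t\<in>S.
        \<alpha> (m x y) (m x z) (\<alpha> x y r s) (\<alpha> x z r t) =
        \<alpha> (m y x) (m y z) (\<alpha> y x s r) (\<alpha> y z s t))"

text \<open>The dynamical extension has carrier \<open>S \<times> Y\<close> and this operation.\<close>

definition dyn_ext_op ::
  "('y \<Rightarrow> 'y \<Rightarrow> 'y) \<Rightarrow> ('y \<Rightarrow> 'y \<Rightarrow> 's \<Rightarrow> 's \<Rightarrow> 's) \<Rightarrow> 's \<times> 'y \<Rightarrow> 's \<times> 'y \<Rightarrow> 's \<times> 'y" where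
  "dyn_ext_op m \<alpha> p q = (\<alpha> (snd p) (snd q) (fst p) (fst q), m (snd p) (snd q))"

type_synonym 'a sol = "'a set \<times> ('a \<times> 'a \<Rightarrow> 'a \<times> 'a)"

definition sigma :: "('a \<times> 'a \<Rightarrow> 'a \<times> 'a) \<Rightarrow> 'a \<Rightarrow> 'a \<Rightarrow> 'a" where
  "sigma r x y = fst (r (x, y))"

definition tau :: "('a \<times> 'a \<Rightarrow> 'a \<times> 'a) \<Rightarrow> 'a \<Rightarrow> 'a \<Rightarrow> 'a" where
  "tau r y x = snd (r (x, y))"

definition r12 :: "('a \<times> 'a \<Rightarrow> 'a \<times> 'a) \<Rightarrow> 'a \<times> 'a \<times> 'a \<Rightarrow> 'a \<times> 'a \<times> 'a" where
  "r12 r = (\<lambda>(x, y, z). case r (x, y) of (u, v) \<Rightarrow> (u, v, z))"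

definition r23 :: "('a \<times> 'a \<Rightarrow> 'a \<times> 'a) \<Rightarrow> 'a \<times> 'a \<times> 'a \<Rightarrow> 'a \<times> 'a \<times> 'a" where
  "r23 r = map_prod id r"

definition ybe_solution :: "'a sol \<Rightarrow> bool" where
  "ybe_solution = (\<lambda>(X, r).
     X \<noteq> {} \<and> bij_betw r (X \<times> X) (X \<times> X) \<and>
     (\<forall>p \<in> X \<times> X \<times> X. r12 r (r23 r (r12 r p)) = r23 r (r12 r (r23 r p))))"

definition involutive :: "'a sol \<Rightarrow> bool" where
  "involutive = (\<lambda>(X, r). \<forall>p \<in> X \<times> X. r (r p) = p)"

definition nondegenerate :: "'a sol \<Rightarrow> bool" where
  "nondegenerate = (\<lambda>(X, r).
     \<forall>x\<in>X. bij_betw (sigma r x) X X \<and> bij_betw (tau r x) X X)"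

definition square_free_sol :: "'a sol \<Rightarrow> bool" where
  "square_free_sol = (\<lambda>(X, r). \<forall>x\<in>X. r (x, x) = (x, x))"

definition sol_iso :: "('a \<Rightarrow> 'b) \<Rightarrow> 'a sol \<Rightarrow> 'b sol \<Rightarrow> bool" where
  "sol_iso f = (\<lambda>(X, r) (Z, q).
     bij_betw f X Z \<and> (\<forall>x\<in>X. \<forall>y\<in>X. q (f x, f y) = map_prod f f (r (x, y))))"

definition retract_rel :: "'a sol \<Rightarrow> ('a \<times> 'a) set" where
  "retract_rel = (\<lambda>(X, r). {(x, y) \<in> X \<times> X. \<forall>z\<in>X. sigma r x z = sigma r y z})"

text \<open>The map on classes is written with the union idiom of \<^theory>\<open>HOL.Equiv_Relations\<close>:
  all the classes in each union coincide whenever the map is well defined on the quotient.\<close>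

definition Ret :: "'a sol \<Rightarrow> 'a set sol" where
  "Ret = (\<lambda>(X, r). let R = retract_rel (X, r) in
     (X // R,
      \<lambda>(A, B). (\<Union>x\<in>A. \<Union>y\<in>B. R `` {sigma r x y}, \<Union>x\<in>A. \<Union>y\<in>B. R `` {tau r y x})))"

text \<open>\<open>Ret\<close> changes the type of the elements, so it cannot be iterated as it stands.  The elements
  of an iterated retraction are finite classes of finite classes \dots of elements of the finite
  set \<open>X\<close>; they live in the following type, along which each \<open>Ret\<close> is transported.\<close>

datatype 'a nested = Elem 'a | Class "'a nested fset"

definition nested_class :: "'a nested set \<Rightarrow> 'a nested" where
  "nested_class A = Class (Abs_fset A)"

definition transport_sol :: "('a \<Rightarrow> 'b) \<Rightarrow> 'a sol \<Rightarrow> 'b sol" where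
  "transport_sol f = (\<lambda>(X, r).
     (f ` X, map_prod f f \<circ> r \<circ> map_prod (inv_into X f) (inv_into X f)))"

text \<open>\<open>Ret_iter k P\<close> is \<open>Ret\<close> applied \<open>k\<close> times to \<open>P\<close>, up to the above encoding; the next
  two lemmas show that on finite sets nothing is identified by it.\<close>

definition Ret_iter :: "nat \<Rightarrow> 'a sol \<Rightarrow> 'a nested sol" where
  "Ret_iter k P = ((\<lambda>Q. transport_sol nested_class (Ret Q)) ^^ k) (transport_sol Elem P)"

lemma inj_on_nested_class: "finite X \<Longrightarrow> inj_on nested_class (X // R)" if "R \<subseteq> X \<times> X"
  using that unfolding nested_class_def
  by (intro inj_onI) (metis Abs_fset_inject finite_equiv_class mem_Collect_eq nested.inject(2))

lemma sol_iso_transport: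
  assumes "inj_on f X" "r ` (X \<times> X) \<subseteq> X \<times> X"
  shows "sol_iso f (X, r) (transport_sol f (X, r))"
  using assms by (auto simp: sol_iso_def transport_sol_def bij_betw_def)

definition multipermutation :: "'a sol \<Rightarrow> bool" where
  "multipermutation P \<longleftrightarrow> (\<exists>m>0. card (fst (Ret_iter m P)) = 1)"

end

theory Submission
  imports Defs
begin

text \<open>
  Put coordinates in \<open>\<int>/2\<close> on everything: \<open>a, b, c, d\<close> become the pairs \<open>00, 01, 10, 11\<close>, and
  the elements \<open>1, 2\<close> of \<open>Y\<close> become a third coordinate.  Then \<open>\<alpha>\<^sub>x\<^sub>,\<^sub>x((i,j),(k,l)) = (k, l + k + i)\<close>
  and, for \<open>x \<noteq> y\<close>, \<open>\<alpha>\<^sub>x\<^sub>,\<^sub>y((i,j),(k,l)) = (k + j, l)\<close>.  Both maps are linear, so once it is known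
  which of the elements of \<open>Y\<close> involved are equal, the cocycle condition and the identities
  \<open>x \<cdot> (x \<cdot> y) = y\<close> and \<open>(x \<cdot> y) \<cdot> x = y \<cdot> x\<close> of \<open>X\<close> are linear identities over \<open>\<int>/2\<close>.  The same
  formulas show how to recover \<open>x\<close> from the permutation \<open>y \<mapsto> x \<cdot> y\<close> (lemma \<open>eight_op_faithful\<close>),
  which says that the retract relation is equality.

  These two identities are what turns the cycle set into a solution of the form
  \<open>r(x,y) = (x \<cdot> y, y \<cdot> x)\<close> (lemma \<open>cycle_set_solution\<close>).  The usual solution of a cycle set is
  \<open>(\<sigma>\<^sub>x(y), \<sigma>\<^sub>x(y) \<cdot> x)\<close> with \<open>\<sigma>\<^sub>x\<close> inverse to \<open>y \<mapsto> x \<cdot> y\<close>; the first identity makes \<open>\<sigma>\<^sub>x(y) = x \<cdot> y\<close>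
  and the second one makes the other component \<open>y \<cdot> x\<close>.

  If the retract relation is equality then the retraction is isomorphic to the
  solution itself, and having that property is invariant under isomorphism.  Hence all iterated
  retractions are isomorphic to \<open>(X, r)\<close> (lemma \<open>Ret_iter_iso\<close>) and have eight elements.
\<close>

section \<open>Dynamical extensions\<close>

text \<open>The cocycle condition is the \<open>S\<close>-component of the cycle set identity.\<close>

lemma cycle_set_dyn_ext:
  assumes "dynamical_cocycle Y m S \<alpha>"
  shows "cycle_set (S \<times> Y) (dyn_ext_op m \<alpha>)"
proof -
  have bij: "bij_betw (m x) Y Y" if "x \<in> Y" for x
    using assms that by (auto simp: dynamical_cocycle_def cycle_set_def)
  have perm: "\<alpha> x y s permutes S" if "x \<in> Y" "y \<in> Y" "s \<in> S" for x y s
    using assms that by (auto simp: dynamical_cocycle_def)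
  have fin: "finite (S \<times> Y)"
    using assms by (auto simp: dynamical_cocycle_def)
  have "bij_betw (dyn_ext_op m \<alpha> p) (S \<times> Y) (S \<times> Y)" if p: "p \<in> S \<times> Y" for p
  proof -
    obtain s x where sx: "p = (s, x)" "s \<in> S" "x \<in> Y" using p by auto
    have inj: "inj_on (dyn_ext_op m \<alpha> p) (S \<times> Y)"
    proof (rule inj_onI)
      fix u v assume u: "u \<in> S \<times> Y" and v: "v \<in> S \<times> Y"
        and eq: "dyn_ext_op m \<alpha> p u = dyn_ext_op m \<alpha> p v"
      have snds: "snd u = snd v"
        using eq u v sx bij_betw_imp_inj_on[OF bij[OF sx(3)]]
        by (auto simp: dyn_ext_op_def dest: inj_onD)
      have "\<alpha> x (snd u) s (fst u) = \<alpha> x (snd u) s (fst v)"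
        using eq sx snds by (simp add: dyn_ext_op_def)
      then have "fst u = fst v"
        using permutes_inj[OF perm[of x "snd u" s]] u sx by (auto dest: injD)
      with snds show "u = v" by (simp add: prod_eq_iff)
    qed
    have "dyn_ext_op m \<alpha> p ` (S \<times> Y) \<subseteq> S \<times> Y"
      using sx permutes_in_image[OF perm] bij_betwE[OF bij] by (auto simp: dyn_ext_op_def)
    then show ?thesis
      using endo_inj_surj[OF fin _ inj] inj by (simp add: bij_betw_def)
  qed
  then show ?thesis
    using assms by (auto simp: cycle_set_def dynamical_cocycle_def dyn_ext_op_def)
qed

section \<open>Solutions from cycle sets\<close>

text \<open>Writing \<open>w = y \<cdot> z\<close>, the first component of the braid equation is the cycle set
  identity for \<open>x, y, w\<close>, because \<open>z = y \<cdot> w\<close>; the last component is the same equation with \<open>x\<close> and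
  \<open>z\<close> exchanged.  In the middle component the identity \<open>(p \<cdot> q) \<cdot> p = q \<cdot> p\<close> reduces both sides to \<open>(x \<cdot> w) \<cdot> (x \<cdot> y) = (w \<cdot> x) \<cdot> (w \<cdot> y)\<close>.\<close>

lemma cycle_set_solution:
  assumes cs: "cycle_set X m" and ne: "X \<noteq> {}"
    and inv: "\<And>x y. x \<in> X \<Longrightarrow> y \<in> X \<Longrightarrow> m x (m x y) = y"
    and lri: "\<And>x y. x \<in> X \<Longrightarrow> y \<in> X \<Longrightarrow> m (m x y) x = m y x"
    and r: "\<And>x y. x \<in> X \<Longrightarrow> y \<in> X \<Longrightarrow> r (x, y) = (m x y, m y x)"
  shows "ybe_solution (X, r)" "nondegenerate (X, r)" "involutive (X, r)"
proof -
  have cl: "m x y \<in> X" if "x \<in> X" "y \<in> X" for x y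
    using cs that by (auto simp: cycle_set_def dest: bij_betwE)
  have cyc: "m (m x y) (m x z) = m (m y x) (m y z)" if "x \<in> X" "y \<in> X" "z \<in> X" for x y z
    using cs that by (simp add: cycle_set_def)
  have outer: "m (m x y) (m (m y x) z) = m x (m y z)"
    if "x \<in> X" "y \<in> X" "z \<in> X" for x y z
    by (metis cl cyc inv that)
  have middle: "m (m (m y x) z) (m x y) = m (m (m y z) x) (m z y)"
    if X: "x \<in> X" "y \<in> X" "z \<in> X" for x y z
  proof -
    define w where "w = m y z"
    have w: "w \<in> X" "m y w = z" using X by (auto simp: w_def cl inv)
    have "m (m (m y x) z) (m x y) = m (m (m x y) (m x w)) (m x y)"
      using cyc[of x y w] X w by simp
    also have "\<dots> = m (m x w) (m x y)" using X w by (simp add: lri cl)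
    also have "\<dots> = m (m w x) (m w y)" using X w by (simp add: cyc)
    also have "m w y = m z y" using X by (simp add: w_def lri)
    finally show ?thesis by (simp add: w_def)
  qed
  have rr: "r (r p) = p" if p: "p \<in> X \<times> X" for p
  proof -
    obtain x y where xy: "p = (x, y)" "x \<in> X" "y \<in> X" using p by auto
    have "m (m u v) (m v u) = u" if "u \<in> X" "v \<in> X" for u v
      using that by (metis cl inv lri)
    then show ?thesis using xy by (simp add: r cl)
  qed
  then show "involutive (X, r)" by (simp add: involutive_def)
  have "bij_betw r (X \<times> X) (X \<times> X)"
    by (rule bij_betw_byWitness[where f' = r]) (auto simp: rr r cl)
  moreover have "r12 r (r23 r (r12 r p)) = r23 r (r12 r (r23 r p))" if p: "p \<in> X \<times> X \<times> X" for p
  proof -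
    obtain x y z where xyz: "p = (x, y, z)" "x \<in> X" "y \<in> X" "z \<in> X" using p by auto
    show ?thesis
      using xyz outer[of x y z] outer[of z y x] middle[of x y z]
      by (simp add: r12_def r23_def r cl)
  qed
  ultimately show "ybe_solution (X, r)" using ne by (simp add: ybe_solution_def)
  have "bij_betw (m x) X X" if "x \<in> X" for x
    using cs that by (simp add: cycle_set_def)
  moreover have "bij_betw (sigma r x) X X = bij_betw (m x) X X"
    "bij_betw (tau r x) X X = bij_betw (m x) X X" if "x \<in> X" for x
    using that by (auto simp: sigma_def tau_def r intro!: bij_betw_cong)
  ultimately show "nondegenerate (X, r)" by (simp add: nondegenerate_def)
qed

section \<open>Irretractable solutions\<close>

lemma sol_iso_trans:
  assumes "sol_iso f (X, r) (Z, q)" "sol_iso g (Z, q) (W, p)" "r ` (X \<times> X) \<subseteq> X \<times> X"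
  shows "sol_iso (g \<circ> f) (X, r) (W, p)"
proof -
  have f: "f x \<in> Z" if "x \<in> X" for x
    using assms(1) that by (auto simp: sol_iso_def dest: bij_betwE)
  have "p (g (f x), g (f y)) = map_prod (g \<circ> f) (g \<circ> f) (r (x, y))" if "x \<in> X" "y \<in> X" for x y
    using assms(1,2) that f by (simp add: sol_iso_def flip: map_prod.comp)
  then show ?thesis
    using assms(1,2) by (auto simp: sol_iso_def intro: bij_betw_trans)
qed

lemma sol_iso_closed:
  assumes "sol_iso f (X, r) (Z, q)" "r ` (X \<times> X) \<subseteq> X \<times> X"
  shows "q ` (Z \<times> Z) \<subseteq> Z \<times> Z"
proof -
  have Z: "Z = f ` X" using assms(1) by (simp add: sol_iso_def bij_betw_def)
  have "q (f x, f y) \<in> Z \<times> Z" if "x \<in> X" "y \<in> X" for x y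
  proof -
    have "r (x, y) \<in> X \<times> X" using assms(2) that by blast
    then show ?thesis using assms(1) that by (auto simp: sol_iso_def Z)
  qed
  then show ?thesis unfolding Z by blast
qed

text \<open>The bijection \<open>f\<close> conjugates the permutations \<open>\<sigma>\<^sub>x\<close> to the \<open>\<sigma>\<^bsub>f x\<^esub>\<close>, so it maps one retract
  relation onto the other.\<close>

lemma sol_iso_irretractable:
  assumes iso: "sol_iso f (X, r) (Z, q)" and cl: "r ` (X \<times> X) \<subseteq> X \<times> X"
    and triv: "retract_rel (X, r) = Id_on X"
  shows "retract_rel (Z, q) = Id_on Z"
proof -
  have Z: "Z = f ` X" and inj: "inj_on f X"
    using iso by (auto simp: sol_iso_def bij_betw_def)
  have sig: "sigma q (f x) (f z) = f (sigma r x z)" if "x \<in> X" "z \<in> X" for x z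
    using iso that by (simp add: sol_iso_def sigma_def)
  have mem: "sigma r x z \<in> X" if "x \<in> X" "z \<in> X" for x z
    using cl that by (force simp: sigma_def)
  have "x = y" if xy: "x \<in> X" "y \<in> X"
    and eq: "\<forall>z\<in>X. sigma q (f x) (f z) = sigma q (f y) (f z)" for x y
  proof -
    have "sigma r x z = sigma r y z" if "z \<in> X" for z
      using eq xy that sig mem inj by (metis inj_onD)
    then have "(x, y) \<in> retract_rel (X, r)" using xy by (simp add: retract_rel_def)
    then show ?thesis using triv by auto
  qed
  then show ?thesis unfolding Z by (auto simp: retract_rel_def Id_on_def)
qed

lemma sol_iso_Ret:
  assumes triv: "retract_rel (X, r) = Id_on X" and cl: "r ` (X \<times> X) \<subseteq> X \<times> X"
  shows "sol_iso (\<lambda>x. retract_rel (X, r) `` {x}) (X, r) (Ret (X, r))"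
proof -
  have cls: "Id_on X `` {x} = {x}" if "x \<in> X" for x using that by auto
  have mem: "u \<in> X \<and> v \<in> X" if "x \<in> X" "y \<in> X" "r (x, y) = (u, v)" for x y u v
    using cl that by (metis SigmaE2 image_subset_iff mem_Sigma_iff)
  have "X // Id_on X = (\<lambda>x. Id_on X `` {x}) ` X" by (auto simp: quotient_def)
  moreover have "inj_on (\<lambda>x. Id_on X `` {x}) X" by (auto intro!: inj_onI)
  ultimately show ?thesis
    by (auto simp: sol_iso_def Ret_def Let_def triv bij_betw_def sigma_def tau_def cls
        map_prod_def
        dest: mem split: prod.split)
qed

text \<open>Irretractability has to travel along with the isomorphism in the induction: it is what makes
  the next retraction an isomorphism.  Finiteness is what makes the encoding of classes as
  finite sets injective.\<close>

lemma Ret_iter_iso: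
  assumes fin: "finite X" and cl: "r ` (X \<times> X) \<subseteq> X \<times> X"
    and triv: "retract_rel (X, r) = Id_on X"
  shows "\<exists>f. sol_iso f (X, r) (Ret_iter k (X, r))"
proof (induction k)
  case 0
  have "sol_iso Elem (X, r) (transport_sol Elem (X, r))"
    using cl by (intro sol_iso_transport) (auto intro: inj_onI)
  then show ?case by (auto simp: Ret_iter_def)
next
  case (Suc k)
  obtain f Z q where f: "sol_iso f (X, r) (Z, q)" and Q: "Ret_iter k (X, r) = (Z, q)"
    using Suc by (metis surj_pair)
  have Suc_eq: "Ret_iter (Suc k) (X, r) = transport_sol nested_class (Ret (Z, q))"
    using Q by (simp add: Ret_iter_def)
  have clZ: "q ` (Z \<times> Z) \<subseteq> Z \<times> Z" using f cl by (rule sol_iso_closed)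
  have trivZ: "retract_rel (Z, q) = Id_on Z" using f cl triv by (rule sol_iso_irretractable)
  have finZ: "finite Z" using f fin by (auto simp: sol_iso_def dest: bij_betw_finite)
  obtain g W p where g: "sol_iso g (Z, q) (W, p)" and W: "Ret (Z, q) = (W, p)"
    using sol_iso_Ret[OF trivZ clZ] by (metis surj_pair)
  have clW: "p ` (W \<times> W) \<subseteq> W \<times> W" using g clZ by (rule sol_iso_closed)
  have "W = Z // retract_rel (Z, q)" using W by (simp add: Ret_def Let_def)
  then have "inj_on nested_class W"
    using inj_on_nested_class[of "retract_rel (Z, q)" Z] finZ by (auto simp: trivZ)
  then have h: "sol_iso nested_class (W, p) (transport_sol nested_class (W, p))"
    using clW by (rule sol_iso_transport)
  have gf: "sol_iso (g \<circ> f) (X, r) (W, p)" using f g cl by (rule sol_iso_trans)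
  obtain V v where V: "transport_sol nested_class (W, p) = (V, v)" by fastforce
  have "sol_iso (nested_class \<circ> (g \<circ> f)) (X, r) (V, v)"
    using gf h[unfolded V] cl by (rule sol_iso_trans)
  then show ?case using Suc_eq W V by auto
qed

lemma irretractable_not_multipermutation:
  assumes "finite X" "r ` (X \<times> X) \<subseteq> X \<times> X" "retract_rel (X, r) = Id_on X" "card X \<noteq> 1"
  shows "\<not> multipermutation (X, r)"
proof
  assume "multipermutation (X, r)"
  then obtain k where k: "card (fst (Ret_iter k (X, r))) = 1"
    by (auto simp: multipermutation_def)
  obtain f where f: "sol_iso f (X, r) (Ret_iter k (X, r))"
    using Ret_iter_iso[OF assms(1-3)] by blast
  then have "card X = card (fst (Ret_iter k (X, r)))"
    by (auto simp: sol_iso_def split: prod.splits dest: bij_betw_same_card)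
  with k assms(4) show False by simp
qed

section \<open>The eight-element example\<close>

text \<open>This is \<open>X\<close> in coordinates, where the truth values stand for \<open>\<int>/2\<close>, so that \<open>\<noteq>\<close> is addition.
  The last coordinate tells which element of \<open>Y\<close> is the second component.\<close>

fun eight_op :: "bool \<times> bool \<times> bool \<Rightarrow> bool \<times> bool \<times> bool \<Rightarrow> bool \<times> bool \<times> bool" where
  "eight_op (i, j, n) (k, l, n') =
     (if n = n' then (k, l \<noteq> (k \<noteq> i), n') else (k \<noteq> j, l, n'))"

lemma eight_op_involution: "eight_op p (eight_op p q) = q"
  by (cases p; cases q) auto

lemma eight_op_absorb: "eight_op (eight_op p q) p = eight_op q p"
  by (cases p; cases q) auto

text \<open>Only an element with last coordinate \<open>n\<close> changes the second coordinate of elements with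
  last coordinate \<open>n\<close>, and which ones it changes gives \<open>i\<close>; acting on the other elements it
  gives \<open>j\<close>.\<close>

lemma eight_op_faithful:
  assumes "\<And>z. eight_op p z = eight_op q z"
  shows "p = q"
proof -
  obtain i j n where p: "p = (i, j, n)" by (cases p)
  obtain i' j' n' where q: "q = (i', j', n')" by (cases q)
  have n: "n = n'"
  proof (rule ccontr)
    assume "n \<noteq> n'"
    then show False using assms[of "(\<not> i, True, n)"] by (auto simp: p q)
  qed
  show ?thesis using assms[of "(i, True, n)"] assms[of "(True, True, \<not> n)"] n
    by (auto simp: p q)
qed

theorem mainTheorem2:
  fixes a b c d :: 's
    and S :: "'s set" and Y :: "nat set"
    and m :: "nat \<Rightarrow> nat \<Rightarrow> nat"
    and \<alpha> :: "nat \<Rightarrow> nat \<Rightarrow> 's \<Rightarrow> 's \<Rightarrow> 's"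
    and X :: "('s \<times> nat) set"
    and x1 x2 x3 x4 x5 x6 x7 x8 :: "'s \<times> nat"
    and \<psi> :: "'s \<times> nat \<Rightarrow> 's \<times> nat \<Rightarrow> 's \<times> nat"
    and r :: "('s \<times> nat) \<times> ('s \<times> nat) \<Rightarrow> ('s \<times> nat) \<times> ('s \<times> nat)"
  assumes Y: "Y = {1, 2}" and m: "\<And>x y. x \<in> Y \<Longrightarrow> y \<in> Y \<Longrightarrow> m x y = y"
    and S: "S = {a, b, c, d}" "distinct [a, b, c, d]"
    and \<alpha>_diag_ab: "\<alpha> 1 1 a = transpose c d" "\<alpha> 1 1 b = transpose c d"
                   "\<alpha> 2 2 a = transpose c d" "\<alpha> 2 2 b = transpose c d"
    and \<alpha>_diag_cd: "\<alpha> 1 1 c = transpose a b" "\<alpha> 1 1 d = transpose a b"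
                   "\<alpha> 2 2 c = transpose a b" "\<alpha> 2 2 d = transpose a b"
    and \<alpha>_off_ac: "\<alpha> 1 2 a = id" "\<alpha> 1 2 c = id" "\<alpha> 2 1 a = id" "\<alpha> 2 1 c = id"
    and \<alpha>_off_bd: "\<alpha> 1 2 b = transpose a c \<circ> transpose b d"
                  "\<alpha> 1 2 d = transpose a c \<circ> transpose b d"
                  "\<alpha> 2 1 b = transpose a c \<circ> transpose b d"
                  "\<alpha> 2 1 d = transpose a c \<circ> transpose b d"
    and X: "X = S \<times> Y"
    and x: "x1 = (a, 1)" "x2 = (a, 2)" "x3 = (b, 1)" "x4 = (b, 2)"
           "x5 = (c, 1)" "x6 = (c, 2)" "x7 = (d, 1)" "x8 = (d, 2)"
    and \<psi>: "\<And>x y. x \<in> X \<Longrightarrow> y \<in> X \<Longrightarrow> \<psi> x y = dyn_ext_op m \<alpha> x y"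
    and r: "\<And>x y. x \<in> X \<Longrightarrow> y \<in> X \<Longrightarrow> r (x, y) = (\<psi> x y, \<psi> y x)"
  shows "dynamical_cocycle Y m S \<alpha> \<and>
    X = {x1, x2, x3, x4, x5, x6, x7, x8} \<and>
    square_free_cycle_set X (dyn_ext_op m \<alpha>) \<and>
    (\<forall>y\<in>X. \<psi> x1 y = transpose x5 x7 y) \<and>
    (\<forall>y\<in>X. \<psi> x2 y = transpose x6 x8 y) \<and>
    (\<forall>y\<in>X. \<psi> x3 y = (transpose x2 x6 \<circ> transpose x4 x8 \<circ> transpose x5 x7) y) \<and>
    (\<forall>y\<in>X. \<psi> x4 y = (transpose x1 x5 \<circ> transpose x3 x7 \<circ> transpose x6 x8) y) \<and>
    (\<forall>y\<in>X. \<psi> x5 y = transpose x1 x3 y) \<and>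
    (\<forall>y\<in>X. \<psi> x6 y = transpose x2 x4 y) \<and>
    (\<forall>y\<in>X. \<psi> x7 y = (transpose x1 x3 \<circ> transpose x2 x6 \<circ> transpose x4 x8) y) \<and>
    (\<forall>y\<in>X. \<psi> x8 y = (transpose x1 x5 \<circ> transpose x2 x4 \<circ> transpose x3 x7) y) \<and>
    ybe_solution (X, r) \<and> nondegenerate (X, r) \<and> involutive (X, r) \<and> square_free_sol (X, r) \<and>
    retract_rel (X, r) = Id_on X \<and>
    sol_iso (\<lambda>x. retract_rel (X, r) `` {x}) (X, r) (Ret (X, r)) \<and>
    \<not> multipermutation (X, r)"
proof -
  (* e, l and E turn coordinates over Z/2 into elements of S, Y and X. *)
  define e where "e i j = (if i then if j then d else c else if j then b else a)" for i j
  define l where "l n = (if n then 2 else 1 :: nat)" for n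
  define E where "E = (\<lambda>(i, j, n). (e i j, l n))"
  have ne: "a \<noteq> b" "a \<noteq> c" "a \<noteq> d" "b \<noteq> c" "b \<noteq> d" "c \<noteq> d"
    "b \<noteq> a" "c \<noteq> a" "d \<noteq> a" "c \<noteq> b" "d \<noteq> b" "d \<noteq> c"
    using S(2) by auto
  have e_inj: "e i j = e i' j' \<longleftrightarrow> i = i' \<and> j = j'" for i j i' j'
    by (simp add: e_def ne)
  have S_ex: "\<exists>i j. s = e i j" if "s \<in> S" for s
    using that by (auto simp: S(1) e_def split: if_splits)
  have Y_ex: "\<exists>n. y = l n" if "y \<in> Y" for y
    using that by (force simp: Y l_def)
  have e_S [simp]: "e i j \<in> S" for i j by (simp add: e_def S(1))
  have l_Y [simp]: "l n \<in> Y" for n by (simp add: l_def Y)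
  have E_inj: "E p = E q \<longleftrightarrow> p = q" for p q
    by (cases p; cases q) (auto simp: E_def e_inj l_def split: if_splits)
  have E_X [simp]: "E p \<in> X" for p by (cases p) (simp add: E_def X)
  have X_ex: "\<exists>p. x = E p" if "x \<in> X" for x
    using that S_ex Y_ex by (fastforce simp: E_def X)
  have \<alpha>: "\<alpha> (l n) (l n') (e i j) (e i' j') =
      (if n = n' then e i' (j' \<noteq> (i' \<noteq> i)) else e (i' \<noteq> j) j')" for n n' i j i' j'
    by (cases n; cases n'; cases i; cases j; cases i'; cases j')
      (simp_all add: l_def e_def \<alpha>_diag_ab \<alpha>_diag_cd \<alpha>_off_ac \<alpha>_off_bd transpose_def ne
        del: One_nat_def)

  have bij_m: "bij_betw (m y) Y Y" if "y \<in> Y" for y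
    using bij_betw_cong[of Y "m y" id Y] m that by simp
  have "cycle_set Y m" using bij_m m by (simp add: cycle_set_def)
  moreover have "\<alpha> x y s permutes S" if xys: "x \<in> Y" "y \<in> Y" "s \<in> S" for x y s
  proof -
    have "\<alpha> x y s \<in> {transpose c d, transpose a b, id, transpose a c \<circ> transpose b d}"
      using xys unfolding Y S(1)
      by (auto simp: \<alpha>_diag_ab \<alpha>_diag_cd \<alpha>_off_ac \<alpha>_off_bd simp del: One_nat_def)
    then show ?thesis
      by (auto simp: S(1) intro!: permutes_compose permutes_swap_id)
  qed
  moreover have "\<alpha> (m x y) (m x z) (\<alpha> x y r s) (\<alpha> x z r t) =
      \<alpha> (m y x) (m y z) (\<alpha> y x s r) (\<alpha> y z s t)"
    if mem: "x \<in> Y" "y \<in> Y" "z \<in> Y" "r \<in> S" "s \<in> S" "t \<in> S" for x y z r s t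
  proof -
    obtain nx ny nz where n: "x = l nx" "y = l ny" "z = l nz"
      using Y_ex[of x] Y_ex[of y] Y_ex[of z] mem by blast
    obtain i j i' j' i'' j'' where i: "r = e i j" "s = e i' j'" "t = e i'' j''"
      using S_ex[of r] S_ex[of s] S_ex[of t] mem by blast
    show ?thesis unfolding n i
      by (cases nx; cases ny; cases nz) (auto simp: m \<alpha> e_inj)
  qed
  ultimately have cocycle: "dynamical_cocycle Y m S \<alpha>"
    by (simp add: dynamical_cocycle_def Y S(1))

  have op: "dyn_ext_op m \<alpha> (E p) (E q) = E (eight_op p q)" for p q
    by (cases p; cases q) (auto simp: dyn_ext_op_def E_def \<alpha> m)
  have cs: "cycle_set X (dyn_ext_op m \<alpha>)" unfolding X using cocycle by (rule cycle_set_dyn_ext)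
  have idem: "dyn_ext_op m \<alpha> x x = x" if "x \<in> X" for x
    using X_ex[OF that] by (auto simp: op E_inj)
  have rE: "r (x, y) = (dyn_ext_op m \<alpha> x y, dyn_ext_op m \<alpha> y x)" if "x \<in> X" "y \<in> X" for x y
    using that by (simp add: r \<psi>)
  have Xne: "X \<noteq> {}" by (simp add: X S(1) Y)
  have inv: "dyn_ext_op m \<alpha> x (dyn_ext_op m \<alpha> x y) = y"
    and lri: "dyn_ext_op m \<alpha> (dyn_ext_op m \<alpha> x y) x = dyn_ext_op m \<alpha> y x"
    if "x \<in> X" "y \<in> X" for x y
    using X_ex[OF that(1)] X_ex[OF that(2)]
    by (auto simp: op eight_op_involution eight_op_absorb simp del: eight_op.simps)
  note sol = cycle_set_solution[OF cs Xne inv lri rE]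

  have cl: "r ` (X \<times> X) \<subseteq> X \<times> X"
    using sol(1) by (auto simp: ybe_solution_def bij_betw_def)
  have "x = y" if xy: "x \<in> X" "y \<in> X" and eq: "\<forall>z\<in>X. sigma r x z = sigma r y z" for x y
  proof -
    obtain p q where pq: "x = E p" "y = E q"
      using X_ex[of x] X_ex[of y] xy by blast
    have "eight_op p z = eight_op q z" for z
      using eq[rule_format, of "E z"] by (simp add: pq sigma_def rE op E_inj)
    then show ?thesis using eight_op_faithful[of p q] pq by blast
  qed
  then have triv: "retract_rel (X, r) = Id_on X"
    by (auto simp: retract_rel_def Id_on_def)

  have X8: "X = {x1, x2, x3, x4, x5, x6, x7, x8}" unfolding X S(1) Y x by auto
  have dist: "distinct [x1, x2, x3, x4, x5, x6, x7, x8]" using S(2) by (auto simp: x)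
  have finX: "finite X" by (simp add: X8)
  have cardX: "card X \<noteq> 1" using dist by (simp add: X8)
  have xE: "x1 = E (False, False, False)" "x2 = E (False, False, True)"
    "x3 = E (False, True, False)" "x4 = E (False, True, True)"
    "x5 = E (True, False, False)" "x6 = E (True, False, True)"
    "x7 = E (True, True, False)" "x8 = E (True, True, True)"
    by (simp_all add: x E_def e_def l_def)
  have \<psi>E: "\<psi> (E p) (E q) = E (eight_op p q)" for p q by (simp add: \<psi> op)
  have tables:
    "\<forall>y\<in>X. \<psi> x1 y = transpose x5 x7 y"
    "\<forall>y\<in>X. \<psi> x2 y = transpose x6 x8 y"
    "\<forall>y\<in>X. \<psi> x3 y = (transpose x2 x6 \<circ> transpose x4 x8 \<circ> transpose x5 x7) y"
    "\<forall>y\<in>X. \<psi> x4 y = (transpose x1 x5 \<circ> transpose x3 x7 \<circ> transpose x6 x8) y"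
    "\<forall>y\<in>X. \<psi> x5 y = transpose x1 x3 y"
    "\<forall>y\<in>X. \<psi> x6 y = transpose x2 x4 y"
    "\<forall>y\<in>X. \<psi> x7 y = (transpose x1 x3 \<circ> transpose x2 x6 \<circ> transpose x4 x8) y"
    "\<forall>y\<in>X. \<psi> x8 y = (transpose x1 x5 \<circ> transpose x2 x4 \<circ> transpose x3 x7) y"
    unfolding X8 xE by (simp_all add: \<psi>E transpose_def E_inj)
  have sf: "square_free_sol (X, r)" by (simp add: square_free_sol_def rE idem)
  have sfc: "square_free_cycle_set X (dyn_ext_op m \<alpha>)"
    using cs idem by (simp add: square_free_cycle_set_def)
  show ?thesis
    by (intro conjI cocycle X8 sfc tables sol sf triv sol_iso_Ret[OF triv cl]
        irretractable_not_multipermutation[OF finX cl triv cardX])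
qed

end
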